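(* Let $\mathfrak g$ be a finite-dimensional nilpotent Lie algebra, with base field $F'$ of characteristic zero, that is defined over a field $F\subset F'$. Let $X_1,\dots,X_n$ be a basis of $\mathfrak g$ adapted to the lower central series, let $w_1,\dots,w_n$ be the degrees of the basis elements, and let $c_{ij}^k\in F$ be the structure coefficients in this basis, $[X_i,X_j]=\sum_k c_{ij}^kX_k$. A linear map $\delta:\mathfrak g\to\mathfrak g$ is a derivation that restricts to the identity on $\mathfrak g/[\mathfrak g,\mathfrak g]$ if and only if $$\delta(X_i)=w_iX_i+\sum_{j:\,w_j>w_i}a_{ij}X_j,\qquad i=1,\dots,n,$$ such that, for each triple of indices $i,j,k$ with $w_k>w_i+w_j$, the coefficients $a_{ij}\in F$ satisfy the linear equation $$c_{ij}^k(w_k-w_i-w_j)=\sum_{h:\,w_i<w_h\le w_k-w_j}a_{ih}c_{hj}^k+\sum_{h:\,w_j<w_h\le w_k-w_i}a_{jh}c_{ih}^k-\sum_{h:\,w_i+w_j\le w_h<w_k}c_{ij}^ha_{hk}.$$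
   Context: A Lie algebra $\mathfrak g$ with base field $F'$ is defined over a field $F\subset F'$ if it has a basis such that the structure coefficients in that basis are all elements of $F$. The lower central series is $\mathfrak g=\mathfrak g^{(1)}\supset\mathfrak g^{(2)}\supset\cdots$ with $\mathfrak g^{(i+1)}=[\mathfrak g,\mathfrak g^{(i)}]$. A basis $X_1,\dots,X_n$ of $\mathfrak g$ is adapted to the lower central series if for every non-zero $\mathfrak g^{(i)}$ there is an index $n_i\in\mathbb N$ such that $X_{n_i},\dots,X_n$ is a basis of $\mathfrak g^{(i)}$. The degree of $X_i$ is $w_i=\max\{j\in\mathbb N:X_i\in\mathfrak g^{(j)}\}$. That $\delta$ restricts to the identity on $\mathfrak g/[\mathfrak g,\mathfrak g]$ means that the map $\mathfrak g/[\mathfrak g,\mathfrak g]\to\mathfrak g/[\mathfrak g,\mathfrak g]$ induced by $\delta$ is the identity map.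
   Formalization: For F ≠ F' the "only if" part with a_ij in F is false (Heisenberg algebra, a_13 = π). Proved instead: the equivalence with a_ij in F' for every linear δ, and with a_ij in F for every δ whose matrix in the basis X_1,…,X_n has entries in F. *)

theory Defs
  imports Complex_Main
begin

definition is_subfield :: "'f::field set \<Rightarrow> bool" where
  "is_subfield F \<longleftrightarrow> 0 \<in> F \<and> 1 \<in> F \<and>
     (\<forall>x\<in>F. \<forall>y\<in>F. x + y \<in> F \<and> x * y \<in> F) \<and> (\<forall>x\<in>F. - x \<in> F \<and> inverse x \<in> F)"

locale lie_algebra = vector_space scale
  for scale :: "'f::field \<Rightarrow> 'v::ab_group_add \<Rightarrow> 'v" +
  fixes bracket :: "'v \<Rightarrow> 'v \<Rightarrow> 'v"
  assumes linear_left: "Vector_Spaces.linear scale scale (\<lambda>x. bracket x y)"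
    and linear_right: "Vector_Spaces.linear scale scale (\<lambda>y. bracket x y)"
    and alternating: "bracket x x = 0"
    and jacobi: "bracket x (bracket y z) + bracket y (bracket z x) + bracket z (bracket x y) = 0"
begin

definition finite_dimensional :: bool where
  "finite_dimensional \<longleftrightarrow> (\<exists>B. finite B \<and> span B = UNIV)"

definition product_space :: "'v set \<Rightarrow> 'v set \<Rightarrow> 'v set" where
  "product_space A B = span {bracket x y | x y. x \<in> A \<and> y \<in> B}"

text \<open>The series is indexed from 1; the value at index 0 is a convention that plays no role.\<close>

fun lower_central :: "nat \<Rightarrow> 'v set" where
  "lower_central 0 = UNIV"
| "lower_central (Suc 0) = UNIV"
| "lower_central (Suc (Suc i)) = product_space UNIV (lower_central (Suc i))"

definition nilpotent :: bool where
  "nilpotent \<longleftrightarrow> (\<exists>i\<ge>1. lower_central i = {0})"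

text \<open>Bases are families \<open>X\<close> of vectors, of which only the members with index in \<open>I\<close> matter.\<close>

definition basis_of :: "(nat \<Rightarrow> 'v) \<Rightarrow> nat set \<Rightarrow> 'v set \<Rightarrow> bool" where
  "basis_of X I S \<longleftrightarrow> inj_on X I \<and> independent (X ` I) \<and> span (X ` I) = S"

definition structure_coefficients ::
    "(nat \<Rightarrow> 'v) \<Rightarrow> nat \<Rightarrow> (nat \<Rightarrow> nat \<Rightarrow> nat \<Rightarrow> 'f) \<Rightarrow> bool" where
  "structure_coefficients X n c \<longleftrightarrow>
     (\<forall>i\<in>{1..n}. \<forall>j\<in>{1..n}. bracket (X i) (X j) = (\<Sum>k=1..n. scale (c i j k) (X k)))"

definition defined_over :: "'f set \<Rightarrow> bool" where
  "defined_over F \<longleftrightarrow> (\<exists>n X c. basis_of X {1..n} UNIV \<and> structure_coefficients X n c \<and>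
     (\<forall>i\<in>{1..n}. \<forall>j\<in>{1..n}. \<forall>k\<in>{1..n}. c i j k \<in> F))"

definition adapted_basis :: "(nat \<Rightarrow> 'v) \<Rightarrow> nat \<Rightarrow> bool" where
  "adapted_basis X n \<longleftrightarrow> basis_of X {1..n} UNIV \<and>
     (\<forall>i\<ge>1. lower_central i \<noteq> {0} \<longrightarrow> (\<exists>m\<in>{1..n}. basis_of X {m..n} (lower_central i)))"

text \<open>In a nilpotent Lie algebra the set below is finite for every \<open>x \<noteq> 0\<close>.\<close>

definition degree :: "'v \<Rightarrow> nat" where
  "degree x = Max {j. 1 \<le> j \<and> x \<in> lower_central j}"

definition derivation :: "('v \<Rightarrow> 'v) \<Rightarrow> bool" where
  "derivation \<delta> \<longleftrightarrow> Vector_Spaces.linear scale scale \<delta> \<and>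
     (\<forall>x y. \<delta> (bracket x y) = bracket (\<delta> x) y + bracket x (\<delta> y))"

definition abelianization_rel :: "('v \<times> 'v) set" where
  "abelianization_rel = {(x, y). x - y \<in> product_space UNIV UNIV}"

definition abelianization :: "'v set set" where
  "abelianization = UNIV // abelianization_rel"

text \<open>The map induced by \<open>\<delta>\<close> on cosets of the derived algebra, by the usual union-of-classes
  lifting; if \<open>\<delta>\<close> maps the derived algebra into itself, as every derivation does, its value at
  the coset of \<open>x\<close> is the coset of \<open>\<delta> x\<close>.\<close>

definition induced_map :: "('v \<Rightarrow> 'v) \<Rightarrow> 'v set \<Rightarrow> 'v set" where
  "induced_map \<delta> C = (\<Union>x\<in>C. abelianization_rel `` {\<delta> x})"

definition identity_on_abelianization :: "('v \<Rightarrow> 'v) \<Rightarrow> bool" where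
  "identity_on_abelianization \<delta> \<longleftrightarrow> (\<forall>C\<in>abelianization. induced_map \<delta> C = C)"

definition map_defined_over :: "'f set \<Rightarrow> (nat \<Rightarrow> 'v) \<Rightarrow> nat \<Rightarrow> ('v \<Rightarrow> 'v) \<Rightarrow> bool" where
  "map_defined_over F X n \<delta> \<longleftrightarrow> (\<exists>b. (\<forall>i\<in>{1..n}. \<forall>j\<in>{1..n}. b i j \<in> F) \<and>
     (\<forall>i\<in>{1..n}. \<delta> (X i) = (\<Sum>j=1..n. scale (b i j) (X j))))"

end

text \<open>The subtractions of degrees in the summation ranges are not truncated,
  since \<open>w k > w i + w j\<close> there.\<close>

definition coefficient_equations ::
    "nat \<Rightarrow> (nat \<Rightarrow> nat) \<Rightarrow> (nat \<Rightarrow> nat \<Rightarrow> nat \<Rightarrow> 'f::field) \<Rightarrow> (nat \<Rightarrow> nat \<Rightarrow> 'f) \<Rightarrow> bool" where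
  "coefficient_equations n w c a \<longleftrightarrow>
     (\<forall>i\<in>{1..n}. \<forall>j\<in>{1..n}. \<forall>k\<in>{1..n}. w k > w i + w j \<longrightarrow>
        c i j k * (of_nat (w k) - of_nat (w i) - of_nat (w j)) =
          (\<Sum>h | h \<in> {1..n} \<and> w i < w h \<and> w h \<le> w k - w j. a i h * c h j k)
        + (\<Sum>h | h \<in> {1..n} \<and> w j < w h \<and> w h \<le> w k - w i. a j h * c i h k)
        - (\<Sum>h | h \<in> {1..n} \<and> w i + w j \<le> w h \<and> w h < w k. c i j h * a h k))"

end

theory Submission
  imports Defs
begin

text \<open>Let \<open>L\<^sub>j\<close> be the lower central series. In an adapted basis \<open>L\<^sub>j\<close> is spanned by the \<open>X\<^sub>i\<close> with \<open>w\<^sub>i \<ge> j\<close>, and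
  \<open>[L\<^sub>i, L\<^sub>j] \<subseteq> L\<^sub>i\<^sub>+\<^sub>j\<close> makes \<open>c\<^sub>i\<^sub>j\<^sup>k\<close> vanish for \<open>w\<^sub>k < w\<^sub>i + w\<^sub>j\<close>. A derivation that is the
  identity modulo \<open>L\<^sub>2\<close> acts as multiplication by \<open>j\<close> on \<open>L\<^sub>j / L\<^sub>j\<^sub>+\<^sub>1\<close>, by induction along
  \<open>L\<^sub>j\<^sub>+\<^sub>1 = [L\<^sub>1, L\<^sub>j]\<close>. Comparing \<open>X\<^sub>k\<close>-coefficients in the Leibniz rule for \<open>[X\<^sub>i, X\<^sub>j]\<close> gives the
  equations; for \<open>w\<^sub>k \<le> w\<^sub>i + w\<^sub>j\<close> every term in them vanishes.\<close>

context lie_algebra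
begin

section \<open>Bilinearity, antisymmetry and the Jacobi identity\<close>

lemma module_hom_left: "module_hom scale scale (\<lambda>x. bracket x y)"
  using linear_left by (simp add: linear_iff_module_hom)

lemma module_hom_right: "module_hom scale scale (\<lambda>y. bracket x y)"
  using linear_right by (simp add: linear_iff_module_hom)

lemmas bracket_left =
  module_hom_left[THEN module_hom.add] module_hom_left[THEN module_hom.scale]
  module_hom_left[THEN module_hom.zero] module_hom_left[THEN module_hom.diff]
  module_hom_left[THEN module_hom.neg]

lemmas bracket_right =
  module_hom_right[THEN module_hom.add] module_hom_right[THEN module_hom.scale]
  module_hom_right[THEN module_hom.zero] module_hom_right[THEN module_hom.diff]
  module_hom_right[THEN module_hom.neg]

lemmas bracket_sum_left = module_hom_left[THEN module_hom.sum]
lemmas bracket_sum_right = module_hom_right[THEN module_hom.sum]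

lemma bracket_swap: "bracket x y = - bracket y x"
proof -
  have "bracket (x + y) (x + y) = bracket x x + bracket x y + (bracket y x + bracket y y)"
    by (simp only: bracket_left bracket_right add_ac)
  then have "bracket x y + bracket y x = 0"
    by (simp add: alternating)
  then show ?thesis by (simp add: eq_neg_iff_add_eq_0)
qed

text \<open>The Jacobi identity in the form \<open>ad [x,y] = [ad x, ad y]\<close>: an outer bracket
  is moved inside, as the induction in \<open>bracket_lower_central\<close> requires.\<close>

lemma bracket_bracket: "bracket (bracket x y) z = bracket x (bracket y z) - bracket y (bracket x z)"
proof -
  have "bracket y (bracket z x) = - bracket y (bracket x z)"
    by (subst bracket_swap[of z x]) (simp add: bracket_right)
  moreover have "bracket z (bracket x y) = - bracket (bracket x y) z"
    by (rule bracket_swap)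
  ultimately show ?thesis
    using jacobi[of x y z] by (simp add: algebra_simps)
qed

section \<open>The lower central series and its products\<close>

lemma lower_central_Suc:
  "1 \<le> j \<Longrightarrow> lower_central (Suc j) = product_space UNIV (lower_central j)"
  by (cases j) auto

lemma subspace_product_space: "subspace (product_space A B)"
  by (simp add: product_space_def)

lemma subspace_lower_central: "subspace (lower_central j)"
  by (cases j rule: lower_central.cases) (auto simp: subspace_product_space)

lemma lower_central_2: "lower_central 2 = product_space UNIV UNIV"
  by (simp add: numeral_2_eq_2)

lemma bracket_in_product_space: "x \<in> A \<Longrightarrow> y \<in> B \<Longrightarrow> bracket x y \<in> product_space A B"
  unfolding product_space_def by (rule span_base) blast

lemma product_space_induct [consumes 1, case_names subspace bracket]:
  assumes "z \<in> product_space A B"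
    and "subspace {z. P z}"
    and "\<And>x y. x \<in> A \<Longrightarrow> y \<in> B \<Longrightarrow> P (bracket x y)"
  shows "P z"
  using assms(1) unfolding product_space_def
  by (rule span_induct[where P = P]) (use assms in auto)

lemma product_space_mono: "B \<subseteq> C \<Longrightarrow> product_space A B \<subseteq> product_space A C"
  unfolding product_space_def by (rule span_mono) blast

lemma lower_central_antimono: "i \<le> j \<Longrightarrow> lower_central j \<subseteq> lower_central i"
proof (induction rule: dec_induct)
  case (step m)
  have "lower_central (Suc m) \<subseteq> lower_central m"
  \<comment> \<open>At 0 and 1 the larger term is \<open>UNIV\<close>; from there on the inclusion
    is propagated by monotonicity of the product.\<close>
  proof (induction m rule: lower_central.induct)
    case (3 i)
    show ?case
      using product_space_mono[OF 3] by simp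
  qed auto
  with step.IH show ?case by (rule order_trans[rotated])
qed simp

text \<open>Induction on \<open>i\<close>. On a generator \<open>[u,v]\<close> of
  \<open>L_(i+1)\<close> with \<open>v\<close> in \<open>L_i\<close>, \<open>bracket_bracket\<close>
  gives \<open>[[u,v],y] = [u,[v,y]] - [v,[u,y]]\<close>. The first term uses the hypothesis for
  \<open>j\<close>, the second uses it for \<open>j + 1\<close>, since \<open>[u,y]\<close> lies in
  \<open>L_(j+1)\<close>; hence \<open>j\<close> is generalized.\<close>

lemma bracket_lower_central:
  assumes "1 \<le> i" "1 \<le> j" "x \<in> lower_central i" "y \<in> lower_central j"
  shows "bracket x y \<in> lower_central (i + j)"
  using assms
proof (induction i arbitrary: j x y rule: dec_induct)
  case base
  then show ?case by (simp add: lower_central_Suc bracket_in_product_space)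
next
  case (step i)
  have x: "x \<in> product_space UNIV (lower_central i)"
    using step by (simp add: lower_central_Suc)
  note sub = subspace_lower_central[of "Suc i + j"]
  from x show ?case
  proof (induction rule: product_space_induct)
    case subspace
    show ?case
      by (rule subspaceI)
        (simp_all only: mem_Collect_eq bracket_left subspace_add[OF sub] subspace_scale[OF sub]
          subspace_0[OF sub])
  next
    case (bracket u v)
    have "bracket v y \<in> lower_central (i + j)"
      using step bracket by blast
    then have 1: "bracket u (bracket v y) \<in> lower_central (Suc i + j)"
      using step by (simp add: lower_central_Suc bracket_in_product_space)
    have "bracket u y \<in> lower_central (Suc j)"
      using step by (simp add: lower_central_Suc bracket_in_product_space)
    then have "bracket v (bracket u y) \<in> lower_central (i + Suc j)"
      using step bracket by (intro step.IH) auto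
    with 1 show ?case
      unfolding bracket_bracket by (intro subspace_diff[OF sub]) simp_all
  qed
qed

section \<open>Maps and derivations that are the identity modulo \<open>L_2\<close>\<close>

lemma identity_on_abelianization_iff:
  "identity_on_abelianization \<delta> \<longleftrightarrow> (\<forall>x. \<delta> x - x \<in> lower_central 2)"
proof -
  note sub = subspace_product_space[of UNIV UNIV]
  have rel: "abelianization_rel `` {x} = {y. y - x \<in> product_space UNIV UNIV}" for x
  proof -
    have "x - y \<in> product_space UNIV UNIV \<longleftrightarrow> y - x \<in> product_space UNIV UNIV" for y
      using subspace_neg[OF sub, of "x - y"] subspace_neg[OF sub, of "y - x"] by auto
    then show ?thesis by (auto simp: abelianization_rel_def)
  qed
  have refl: "x \<in> abelianization_rel `` {x}" for x
    by (simp add: rel subspace_0[OF sub])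
  show ?thesis unfolding lower_central_2
  proof
    assume id: "identity_on_abelianization \<delta>"
    show "\<forall>x. \<delta> x - x \<in> product_space UNIV UNIV"
    proof
      fix x
      have "abelianization_rel `` {x} \<in> abelianization"
        by (auto simp: abelianization_def quotient_def)
      then have "induced_map \<delta> (abelianization_rel `` {x}) = abelianization_rel `` {x}"
        using id by (simp add: identity_on_abelianization_def)
      \<comment> \<open>The union in \<open>induced_map\<close> runs over all representatives, so
        \<open>x\<close> itself contributes the class of \<open>\<delta> x\<close>.\<close>
      moreover have "\<delta> x \<in> induced_map \<delta> (abelianization_rel `` {x})"
        unfolding induced_map_def using refl by blast
      ultimately show "\<delta> x - x \<in> product_space UNIV UNIV"
        by (simp add: rel)
    qed
  next
    assume \<delta>: "\<forall>x. \<delta> x - x \<in> product_space UNIV UNIV"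
    have "induced_map \<delta> (abelianization_rel `` {x}) = abelianization_rel `` {x}" for x
    proof -
      \<comment> \<open>Since \<open>\<delta> y - x = (\<delta> y - y) + (y - x)\<close>, every
        representative \<open>y\<close> contributes the class of \<open>x\<close>, and the union
        collapses to that class.\<close>
      have "abelianization_rel `` {\<delta> y} = abelianization_rel `` {x}"
        if "y \<in> abelianization_rel `` {x}" for y
      proof -
        have *: "\<delta> y - x \<in> product_space UNIV UNIV"
          using subspace_add[OF sub, of "\<delta> y - y" "y - x"] \<delta> that by (simp add: rel)
        have "z - \<delta> y \<in> product_space UNIV UNIV \<longleftrightarrow> z - x \<in> product_space UNIV UNIV" for z
          using subspace_add[OF sub _ *, of "z - \<delta> y"] subspace_diff[OF sub _ *, of "z - x"]
          by auto
        then show ?thesis by (simp add: rel)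
      qed
      then show ?thesis
        unfolding induced_map_def using refl by blast
    qed
    then show "identity_on_abelianization \<delta>"
      by (auto simp: identity_on_abelianization_def abelianization_def quotient_def)
  qed
qed

text \<open>The Leibniz rule gives \<open>(\<delta> - (j+1)) [u,v] = [(\<delta> - 1) u, v] +
  [u, (\<delta> - j) v]\<close>. For \<open>v\<close> in \<open>L_j\<close> the first summand lies
  in \<open>[L_2, L_j]\<close>, the second by induction in \<open>[L_1, L_(j+1)]\<close>, both
  inside \<open>L_(j+2)\<close>.\<close>

lemma derivation_on_lower_central:
  assumes "derivation \<delta>" and id: "\<And>x. \<delta> x - x \<in> lower_central 2"
    and "1 \<le> j" "x \<in> lower_central j"
  shows "\<delta> x - scale (of_nat j) x \<in> lower_central (Suc j)"
  using assms(3,4)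
proof (induction j arbitrary: x rule: dec_induct)
  case base
  then show ?case using id by (simp add: numeral_2_eq_2)
next
  case (step j)
  have leibniz: "\<delta> (bracket x y) = bracket (\<delta> x) y + bracket x (\<delta> y)" for x y
    using assms(1) by (simp add: derivation_def)
  have hom: "module_hom scale scale \<delta>"
    using assms(1) by (simp add: derivation_def linear_iff_module_hom)
  note sub = subspace_lower_central[of "Suc (Suc j)"]
  have "x \<in> product_space UNIV (lower_central j)"
    using step by (simp add: lower_central_Suc)
  then show ?case
  proof (induction rule: product_space_induct)
    case subspace
    show ?case
    proof (rule subspaceI)
      fix x y assume "x \<in> {z. \<delta> z - scale (of_nat (Suc j)) z \<in> lower_central (Suc (Suc j))}"
        and "y \<in> {z. \<delta> z - scale (of_nat (Suc j)) z \<in> lower_central (Suc (Suc j))}"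
      then have "(\<delta> x - scale (of_nat (Suc j)) x) + (\<delta> y - scale (of_nat (Suc j)) y)
          \<in> lower_central (Suc (Suc j))"
        by (intro subspace_add[OF sub]) auto
      then show "x + y \<in> {z. \<delta> z - scale (of_nat (Suc j)) z \<in> lower_central (Suc (Suc j))}"
        by (simp only: mem_Collect_eq module_hom.add[OF hom] scale_right_distrib add_diff_add)
    next
      fix r x assume "x \<in> {z. \<delta> z - scale (of_nat (Suc j)) z \<in> lower_central (Suc (Suc j))}"
      then have "scale r (\<delta> x - scale (of_nat (Suc j)) x) \<in> lower_central (Suc (Suc j))"
        by (intro subspace_scale[OF sub]) auto
      then show "scale r x \<in> {z. \<delta> z - scale (of_nat (Suc j)) z \<in> lower_central (Suc (Suc j))}"
        by (simp only: mem_Collect_eq module_hom.scale[OF hom] scale_right_diff_distrib scale_scale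
            mult.commute)
    qed (use subspace_0[OF sub] in \<open>simp add: module_hom.zero[OF hom]\<close>)
  next
    case (bracket u v)
    have 1: "bracket (\<delta> u - u) v \<in> lower_central (Suc (Suc j))"
      using bracket_lower_central[OF _ step.hyps(1) id[of u] bracket(2)] by simp
    have 2: "bracket u (\<delta> v - scale (of_nat j) v) \<in> lower_central (Suc (Suc j))"
      using step.IH[OF bracket(2)]
      by (metis lower_central_Suc bracket_in_product_space UNIV_I le_add1 plus_1_eq_Suc)
    have "\<delta> (bracket u v) - scale (of_nat (Suc j)) (bracket u v) =
        bracket (\<delta> u - u) v + bracket u (\<delta> v - scale (of_nat j) v)"
      by (simp add: leibniz bracket_left bracket_right scale_left_distrib)
    then show ?case
      using subspace_add[OF sub 1 2] by simp
  qed
qed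

end

section \<open>Coordinates and degrees in an adapted basis\<close>

locale adapted_lie_algebra = lie_algebra scale bracket
  for scale :: "'f::field \<Rightarrow> 'v::ab_group_add \<Rightarrow> 'v" and bracket :: "'v \<Rightarrow> 'v \<Rightarrow> 'v" +
  fixes X :: "nat \<Rightarrow> 'v" and n :: nat and w :: "nat \<Rightarrow> nat"
    and c :: "nat \<Rightarrow> nat \<Rightarrow> nat \<Rightarrow> 'f"
  assumes nilpotent: nilpotent
    and adapted: "adapted_basis X n"
    and w_eq: "i \<in> {1..n} \<Longrightarrow> w i = degree (X i)"
    and structure_coeffs: "structure_coefficients X n c"
begin

lemma basis: "inj_on X {1..n}" "independent (X ` {1..n})" "span (X ` {1..n}) = UNIV"
  using adapted by (auto simp: adapted_basis_def basis_of_def)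

lemma X_nonzero: "i \<in> {1..n} \<Longrightarrow> X i \<noteq> 0"
  using basis(2) dependent_zero by (metis imageI)

lemma bracket_X:
  "i \<in> {1..n} \<Longrightarrow> j \<in> {1..n} \<Longrightarrow> bracket (X i) (X j) = (\<Sum>k=1..n. scale (c i j k) (X k))"
  using structure_coeffs by (simp add: structure_coefficients_def)

lemma coeffs_unique:
  assumes "(\<Sum>k=1..n. scale (u k) (X k)) = (\<Sum>k=1..n. scale (v k) (X k))" "k \<in> {1..n}"
  shows "u k = v k"
proof -
  \<comment> \<open>\<open>independentD\<close> speaks of coefficients indexed by vectors, so
    \<open>u - v\<close> is carried over along the inverse of \<open>X\<close>.\<close>
  let ?t = "\<lambda>x. let k = the_inv_into {1..n} X x in u k - v k"
  have t: "?t (X k) = u k - v k" if "k \<in> {1..n}" for k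
    using that basis(1) by (simp add: the_inv_into_f_f)
  have "(\<Sum>x\<in>X ` {1..n}. scale (?t x) x) = (\<Sum>k=1..n. scale (u k - v k) (X k))"
    unfolding sum.reindex[OF basis(1)] o_def by (intro sum.cong refl) (simp only: t)
  also have "\<dots> = 0"
    using assms(1) by (simp add: scale_left_diff_distrib sum_subtractf)
  finally have "?t (X k) = 0"
    using independentD[OF basis(2), of "X ` {1..n}" ?t "X k"] assms(2) by blast
  with t assms(2) show ?thesis by simp
qed

lemma span_coeffs:
  assumes "x \<in> span (X ` J)" "J \<subseteq> {1..n}"
  obtains u where "x = (\<Sum>k\<in>J. scale (u k) (X k))"
proof -
  have "finite J" using assms(2) finite_subset by blast
  then obtain t where "x = (\<Sum>y\<in>X ` J. scale (t y) y)"
    using assms(1) by (auto simp: span_finite)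
  then have "x = (\<Sum>k\<in>J. scale (t (X k)) (X k))"
    using inj_on_subset[OF basis(1) assms(2)] by (simp add: sum.reindex)
  then show ?thesis by (rule that)
qed

text \<open>A \<open>Max\<close> is meaningful only on a finite nonempty set. Here 1 is always a
  member, and nilpotency bounds the set because \<open>X i\<close> is nonzero. Membership below the
  maximum follows since the series descends.\<close>

lemma X_in_lower_central_iff:
  assumes "i \<in> {1..n}" "1 \<le> j"
  shows "X i \<in> lower_central j \<longleftrightarrow> j \<le> w i"
proof -
  let ?D = "{j. 1 \<le> j \<and> X i \<in> lower_central j}"
  obtain N where N: "lower_central N = {0}"
    using nilpotent by (auto simp: nilpotent_def)
  have "?D \<subseteq> {..N}"
  proof
    fix j assume "j \<in> ?D"
    then show "j \<in> {..N}"
      using lower_central_antimono[of N j] N X_nonzero[OF assms(1)] by force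
  qed
  then have fin: "finite ?D" using finite_subset by blast
  moreover have "1 \<in> ?D" by simp
  ultimately have "Max ?D \<in> ?D" by (intro Max_in) blast+
  moreover have w: "w i = Max ?D"
    using w_eq[OF assms(1)] by (simp add: degree_def)
  ultimately have "X i \<in> lower_central (w i)" by simp
  moreover have "j \<le> w i" if "X i \<in> lower_central j"
    unfolding w using that assms(2) fin by (intro Max_ge) auto
  ultimately show ?thesis using lower_central_antimono by blast
qed

lemma w_pos: "i \<in> {1..n} \<Longrightarrow> 1 \<le> w i"
  using X_in_lower_central_iff[of i 1] by simp

lemma X_in_lower_central_w: "i \<in> {1..n} \<Longrightarrow> X i \<in> lower_central (w i)"
  using X_in_lower_central_iff w_pos by blast

text \<open>Replaces the tail \<open>{m..n}\<close> of an adapted basis by a condition on degrees: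
  the tail has only indices of degree at least \<open>j\<close>, and all \<open>X k\<close> of such
  degree lie in \<open>L_j\<close>. Adaptedness says nothing about a zero term, where the index set
  is empty because no \<open>X k\<close> vanishes.\<close>

lemma lower_central_eq_span:
  assumes "1 \<le> j"
  shows "lower_central j = span (X ` {k \<in> {1..n}. j \<le> w k})"
proof (cases "lower_central j = {0}")
  case True
  then have "{k \<in> {1..n}. j \<le> w k} = {}"
    using X_in_lower_central_iff[OF _ assms] X_nonzero by blast
  then show ?thesis using True by (metis image_empty span_empty)
next
  case False
  then obtain m where "m \<in> {1..n}" "basis_of X {m..n} (lower_central j)"
    using adapted assms unfolding adapted_basis_def by blast
  then have m: "1 \<le> m" "span (X ` {m..n}) = lower_central j"
    by (auto simp: basis_of_def)
  have "X ` {m..n} \<subseteq> X ` {k \<in> {1..n}. j \<le> w k}"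
  proof (rule image_mono, rule subsetI)
    fix k assume k: "k \<in> {m..n}"
    then have "X k \<in> lower_central j"
      unfolding m(2)[symmetric] by (intro span_base imageI)
    moreover have "k \<in> {1..n}" using k m(1) by simp
    ultimately show "k \<in> {k \<in> {1..n}. j \<le> w k}"
      using X_in_lower_central_iff[OF _ assms] by blast
  qed
  then have "lower_central j \<subseteq> span (X ` {k \<in> {1..n}. j \<le> w k})"
    using m(2) span_mono by blast
  moreover have "X ` {k \<in> {1..n}. j \<le> w k} \<subseteq> lower_central j"
    using X_in_lower_central_iff[OF _ assms] by blast
  ultimately show ?thesis
    using span_minimal[OF _ subspace_lower_central] by blast
qed

lemma lower_central_coeffs:
  assumes "1 \<le> j" "x \<in> lower_central j"
  obtains u where "x = (\<Sum>k | k \<in> {1..n} \<and> j \<le> w k. scale (u k) (X k))"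
proof -
  have "x \<in> span (X ` {k \<in> {1..n}. j \<le> w k})"
    using assms by (simp only: lower_central_eq_span)
  moreover have "{k \<in> {1..n}. j \<le> w k} \<subseteq> {1..n}" by blast
  ultimately show ?thesis by (rule span_coeffs[OF _ _ that])
qed

lemma structure_coefficient_zero:
  assumes "i \<in> {1..n}" "j \<in> {1..n}" "k \<in> {1..n}" "w k < w i + w j"
  shows "c i j k = 0"
proof -
  have "bracket (X i) (X j) \<in> lower_central (w i + w j)"
    using assms by (intro bracket_lower_central w_pos X_in_lower_central_w)
  then obtain u where
    "bracket (X i) (X j) = (\<Sum>k | k \<in> {1..n} \<and> w i + w j \<le> w k. scale (u k) (X k))"
    by (rule lower_central_coeffs[OF trans_le_add1[OF w_pos[OF assms(1)]]])
  \<comment> \<open>Padding with zeros gives an expansion over all of \<open>{1..n}\<close>, as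
    \<open>coeffs_unique\<close> expects.\<close>
  also have "\<dots> = (\<Sum>k=1..n. scale (if w i + w j \<le> w k then u k else 0) (X k))"
    by (rule sum.mono_neutral_cong_left) auto
  finally have "c i j k = (if w i + w j \<le> w k then u k else 0)"
    unfolding bracket_X[OF assms(1,2)] by (rule coeffs_unique) (rule assms)
  with assms(4) show ?thesis by simp
qed

section \<open>The Leibniz rule in coordinates\<close>

lemma subspace_basis_UNIV:
  assumes "subspace S" "\<And>i. i \<in> {1..n} \<Longrightarrow> X i \<in> S"
  shows "x \<in> S"
proof -
  have "span (X ` {1..n}) \<subseteq> S"
    using assms(2) by (intro span_minimal[OF _ assms(1)] image_subsetI)
  then show ?thesis unfolding basis(3) by blast
qed

text \<open>Both sides of the Leibniz rule are bilinear, so it extends from the basis one argument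
  at a time: first in \<open>x\<close> with \<open>y = X j\<close> fixed, then in \<open>y\<close>
  for arbitrary \<open>x\<close>.\<close>

lemma derivation_iff_basis:
  assumes "Vector_Spaces.linear scale scale \<delta>"
  shows "derivation \<delta> \<longleftrightarrow> (\<forall>i\<in>{1..n}. \<forall>j\<in>{1..n}.
    \<delta> (bracket (X i) (X j)) = bracket (\<delta> (X i)) (X j) + bracket (X i) (\<delta> (X j)))"
    (is "_ \<longleftrightarrow> ?R")
proof
  assume R: ?R
  have hom: "module_hom scale scale \<delta>"
    using assms by (simp add: linear_iff_module_hom)
  note simps = module_hom.add[OF hom] module_hom.scale[OF hom] module_hom.zero[OF hom]
    bracket_left bracket_right scale_right_distrib add_ac
  let ?P = "\<lambda>x y. \<delta> (bracket x y) = bracket (\<delta> x) y + bracket x (\<delta> y)"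
  have "?P x (X j)" if "j \<in> {1..n}" for x j
  proof -
    have "subspace {x. ?P x (X j)}"
      by (rule subspaceI) (simp_all add: simps)
    then have "x \<in> {x. ?P x (X j)}"
      by (rule subspace_basis_UNIV) (use R that in auto)
    then show ?thesis by simp
  qed
  then have basis_right: "X j \<in> {y. ?P x y}" if "j \<in> {1..n}" for x j
    using that by simp
  have "y \<in> {y. ?P x y}" for x y
  proof -
    have "subspace {y. ?P x y}"
      by (rule subspaceI) (simp_all add: simps)
    then show ?thesis
      by (rule subspace_basis_UNIV) (rule basis_right)
  qed
  with assms show "derivation \<delta>" by (simp add: derivation_def)
qed (simp add: derivation_def)

lemma derivation_iff_coeffs:
  assumes lin: "Vector_Spaces.linear scale scale \<delta>"
    and d: "\<And>i. i \<in> {1..n} \<Longrightarrow> \<delta> (X i) = (\<Sum>k=1..n. scale (d i k) (X k))"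
  shows "derivation \<delta> \<longleftrightarrow> (\<forall>i\<in>{1..n}. \<forall>j\<in>{1..n}. \<forall>k\<in>{1..n}.
    (\<Sum>h=1..n. c i j h * d h k) = (\<Sum>h=1..n. d i h * c h j k) + (\<Sum>h=1..n. d j h * c i h k))"
proof -
  have hom: "module_hom scale scale \<delta>"
    using lin by (simp add: linear_iff_module_hom)
  \<comment> \<open>Each of the three Leibniz terms is a combination of expanded vectors; its
    coordinates are a product of coefficient arrays.\<close>
  have comb: "(\<Sum>h=1..n. scale (f h) (\<Sum>k=1..n. scale (g h k) (X k))) =
      (\<Sum>k=1..n. scale (\<Sum>h=1..n. f h * g h k) (X k))" for f g
  proof -
    have "(\<Sum>h=1..n. scale (f h) (\<Sum>k=1..n. scale (g h k) (X k))) =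
        (\<Sum>h=1..n. \<Sum>k=1..n. scale (f h * g h k) (X k))"
      by (simp only: scale_sum_right scale_scale)
    also have "\<dots> = (\<Sum>k=1..n. \<Sum>h=1..n. scale (f h * g h k) (X k))"
      by (rule sum.swap)
    finally show ?thesis by (simp only: scale_sum_left)
  qed
  have "\<delta> (bracket (X i) (X j)) = bracket (\<delta> (X i)) (X j) + bracket (X i) (\<delta> (X j)) \<longleftrightarrow>
      (\<forall>k\<in>{1..n}. (\<Sum>h=1..n. c i j h * d h k) =
        (\<Sum>h=1..n. d i h * c h j k) + (\<Sum>h=1..n. d j h * c i h k))"
    if ij: "i \<in> {1..n}" "j \<in> {1..n}" for i j
  proof -
    have "\<delta> (bracket (X i) (X j)) = (\<Sum>h=1..n. scale (c i j h) (\<Sum>k=1..n. scale (d h k) (X k)))"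
      unfolding bracket_X[OF ij] module_hom.sum[OF hom] module_hom.scale[OF hom]
      by (intro sum.cong refl arg_cong[where f = "scale _"] d)
    then have 1: "\<delta> (bracket (X i) (X j)) = (\<Sum>k=1..n. scale (\<Sum>h=1..n. c i j h * d h k) (X k))"
      by (simp only: comb)
    have "bracket (\<delta> (X i)) (X j) = (\<Sum>h=1..n. scale (d i h) (\<Sum>k=1..n. scale (c h j k) (X k)))"
      unfolding d[OF ij(1)] bracket_sum_left bracket_left
      by (intro sum.cong refl arg_cong[where f = "scale _"] bracket_X ij)
    then have 2: "bracket (\<delta> (X i)) (X j) = (\<Sum>k=1..n. scale (\<Sum>h=1..n. d i h * c h j k) (X k))"
      by (simp only: comb)
    have "bracket (X i) (\<delta> (X j)) = (\<Sum>h=1..n. scale (d j h) (\<Sum>k=1..n. scale (c i h k) (X k)))"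
      unfolding d[OF ij(2)] bracket_sum_right bracket_right
      by (intro sum.cong refl arg_cong[where f = "scale _"] bracket_X ij)
    then have 3: "bracket (X i) (\<delta> (X j)) = (\<Sum>k=1..n. scale (\<Sum>h=1..n. d j h * c i h k) (X k))"
      by (simp only: comb)
    have 4: "bracket (\<delta> (X i)) (X j) + bracket (X i) (\<delta> (X j)) =
        (\<Sum>k=1..n. scale ((\<Sum>h=1..n. d i h * c h j k) + (\<Sum>h=1..n. d j h * c i h k)) (X k))"
      unfolding 2 3 by (simp only: scale_left_distrib sum.distrib)
    show ?thesis
      unfolding 1 4 by (auto simp only: intro: coeffs_unique intro!: sum.cong)
  qed
  then show ?thesis
    using derivation_iff_basis[OF lin] by simp
qed

section \<open>Maps of graded form and the coefficient equations\<close>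

definition graded_coeffs :: "('v \<Rightarrow> 'v) \<Rightarrow> (nat \<Rightarrow> nat \<Rightarrow> 'f) \<Rightarrow> bool" where
  "graded_coeffs \<delta> a \<longleftrightarrow> (\<forall>i\<in>{1..n}. \<delta> (X i) = scale (of_nat (w i)) (X i)
    + (\<Sum>j | j \<in> {1..n} \<and> w j > w i. scale (a i j) (X j)))"

text \<open>Supplies the full matrix of \<open>\<delta>\<close>, to which
  \<open>coeffs_unique\<close> and \<open>derivation_iff_coeffs\<close> apply. Entries
  \<open>a i k\<close> with \<open>w k \<le> w i\<close> do not enter it.\<close>

lemma graded_coeffs_expansion:
  assumes "graded_coeffs \<delta> a" "i \<in> {1..n}"
  shows "\<delta> (X i) =
    (\<Sum>k=1..n. scale (if k = i then of_nat (w i) else if w k > w i then a i k else 0) (X k))"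
proof -
  have "(\<Sum>k=1..n. scale (if k = i then of_nat (w i) else if w k > w i then a i k else 0) (X k)) =
      scale (of_nat (w i)) (X i) + (\<Sum>k\<in>{1..n} - {i}. scale (if w k > w i then a i k else 0) (X k))"
    by (subst sum.remove[OF _ assms(2)]) simp_all
  also have "(\<Sum>k\<in>{1..n} - {i}. scale (if w k > w i then a i k else 0) (X k)) =
      (\<Sum>j | j \<in> {1..n} \<and> w j > w i. scale (a i j) (X j))"
    by (rule sum.mono_neutral_cong_right) auto
  also have "scale (of_nat (w i)) (X i) + \<dots> = \<delta> (X i)"
    using assms unfolding graded_coeffs_def by simp
  finally show ?thesis by (rule sym)
qed

text \<open>Splitting off the diagonal entries of \<open>d\<close> produces \<open>c i j k\<close>
  times \<open>w k\<close>, \<open>w i\<close> and \<open>w j\<close>. The zeros of \<open>d\<close>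
  and of \<open>c\<close> cut the remaining sums down to the stated ranges.\<close>

lemma graded_equations_iff:
  fixes a :: "nat \<Rightarrow> nat \<Rightarrow> 'f"
  defines "d \<equiv> \<lambda>i k. if k = i then of_nat (w i) else if w k > w i then a i k else 0"
  shows "(\<forall>i\<in>{1..n}. \<forall>j\<in>{1..n}. \<forall>k\<in>{1..n}.
      (\<Sum>h=1..n. c i j h * d h k) = (\<Sum>h=1..n. d i h * c h j k) + (\<Sum>h=1..n. d j h * c i h k))
    \<longleftrightarrow> coefficient_equations n w c a"
proof -
  define R1 where "R1 i j k = (\<Sum>h | h \<in> {1..n} \<and> w i < w h \<and> w h \<le> w k - w j. a i h * c h j k)" for i j k
  define R2 where "R2 i j k = (\<Sum>h | h \<in> {1..n} \<and> w j < w h \<and> w h \<le> w k - w i. a j h * c i h k)" for i j k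
  define R3 where "R3 i j k = (\<Sum>h | h \<in> {1..n} \<and> w i + w j \<le> w h \<and> w h < w k. c i j h * a h k)" for i j k
  have "((\<Sum>h=1..n. c i j h * d h k) = (\<Sum>h=1..n. d i h * c h j k) + (\<Sum>h=1..n. d j h * c i h k))
      \<longleftrightarrow> (w k > w i + w j \<longrightarrow>
        c i j k * (of_nat (w k) - of_nat (w i) - of_nat (w j)) = R1 i j k + R2 i j k - R3 i j k)"
    if ijk: "i \<in> {1..n}" "j \<in> {1..n}" "k \<in> {1..n}" for i j k
  proof -
    have "(\<Sum>h=1..n. c i j h * d h k) = c i j k * of_nat (w k) + (\<Sum>h\<in>{1..n} - {k}. c i j h * d h k)"
      by (subst sum.remove[OF _ ijk(3)]) (simp_all add: d_def)
    \<comment> \<open>The lower bound on \<open>w h\<close> comes from the zeros of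
      \<open>c i j h\<close>, the upper bound from those of \<open>d h k\<close>.\<close>
    also have "(\<Sum>h\<in>{1..n} - {k}. c i j h * d h k) = R3 i j k"
      unfolding R3_def d_def
      by (rule sum.mono_neutral_cong_right)
        (use ijk in \<open>auto intro: structure_coefficient_zero simp: not_le\<close>)
    finally have 1: "(\<Sum>h=1..n. c i j h * d h k) = c i j k * of_nat (w k) + R3 i j k" .
    have "(\<Sum>h=1..n. d i h * c h j k) = of_nat (w i) * c i j k + (\<Sum>h\<in>{1..n} - {i}. d i h * c h j k)"
      by (subst sum.remove[OF _ ijk(1)]) (simp_all add: d_def)
    \<comment> \<open>Now \<open>d i h\<close> gives the lower bound and \<open>c h j k\<close> the
      upper one. If \<open>w h > w k - w j\<close>, then \<open>w k < w h + w j\<close>, even when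
      the subtraction truncates.\<close>
    also have "(\<Sum>h\<in>{1..n} - {i}. d i h * c h j k) = R1 i j k"
      unfolding R1_def d_def
      by (rule sum.mono_neutral_cong_right)
        (use ijk in \<open>auto intro: structure_coefficient_zero simp: not_le\<close>)
    finally have 2: "(\<Sum>h=1..n. d i h * c h j k) = of_nat (w i) * c i j k + R1 i j k" .
    have "(\<Sum>h=1..n. d j h * c i h k) = of_nat (w j) * c i j k + (\<Sum>h\<in>{1..n} - {j}. d j h * c i h k)"
      by (subst sum.remove[OF _ ijk(2)]) (simp_all add: d_def)
    also have "(\<Sum>h\<in>{1..n} - {j}. d j h * c i h k) = R2 i j k"
      unfolding R2_def d_def
      by (rule sum.mono_neutral_cong_right)
        (use ijk in \<open>auto intro: structure_coefficient_zero simp: not_le\<close>)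
    finally have 3: "(\<Sum>h=1..n. d j h * c i h k) = of_nat (w j) * c i j k + R2 i j k" .
    show ?thesis
    proof (cases "w k > w i + w j")
      case True
      then show ?thesis unfolding 1 2 3 by (simp add: algebra_simps)
    next
      case False
      \<comment> \<open>All three index ranges are empty. What remains is
        \<open>c i j k * (w k - w i - w j) = 0\<close>: either the degrees add up or
        \<open>c i j k\<close> vanishes.\<close>
      have "R1 i j k = 0" "R2 i j k = 0" "R3 i j k = 0"
        unfolding R1_def R2_def R3_def using False by (auto intro!: sum.neutral)
      moreover have "c i j k * of_nat (w k) = of_nat (w i) * c i j k + of_nat (w j) * c i j k"
      proof (cases "w k = w i + w j")
        case True
        then show ?thesis by (simp add: algebra_simps)
      next
        case 2: False
        with False have "c i j k = 0"
          using ijk by (intro structure_coefficient_zero) auto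
        then show ?thesis by simp
      qed
      ultimately show ?thesis unfolding 1 2 3 using False by simp
    qed
  qed
  then show ?thesis
    unfolding coefficient_equations_def R1_def R2_def R3_def by simp
qed

lemma derivation_iff_coefficient_equations:
  assumes "Vector_Spaces.linear scale scale \<delta>" and a: "graded_coeffs \<delta> a"
  shows "derivation \<delta> \<longleftrightarrow> coefficient_equations n w c a"
  unfolding graded_equations_iff[of a, symmetric]
  by (rule derivation_iff_coeffs[OF assms(1) graded_coeffs_expansion[OF a]])

text \<open>By linearity the basis suffices. There \<open>\<delta> (X i) - X i\<close> is
  \<open>(w i - 1) X i\<close> plus terms of degree above \<open>w i \<ge> 1\<close>, which lie in
  \<open>L_2\<close>; the first term is zero if \<open>w i = 1\<close> and otherwise
  \<open>X i\<close> is in \<open>L_2\<close>.\<close>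

lemma identity_on_abelianization_if_graded:
  assumes "Vector_Spaces.linear scale scale \<delta>" and a: "graded_coeffs \<delta> a"
  shows "identity_on_abelianization \<delta>"
proof -
  have hom: "module_hom scale scale \<delta>"
    using assms(1) by (simp add: linear_iff_module_hom)
  note sub = subspace_lower_central[of 2]
  have S: "subspace {x. \<delta> x - x \<in> lower_central 2}"
  proof (rule subspaceI)
    fix x y assume "x \<in> {x. \<delta> x - x \<in> lower_central 2}" "y \<in> {x. \<delta> x - x \<in> lower_central 2}"
    then show "x + y \<in> {x. \<delta> x - x \<in> lower_central 2}"
      using subspace_add[OF sub, of "\<delta> x - x" "\<delta> y - y"]
      by (simp add: module_hom.add[OF hom] add_diff_add)
  next
    fix r x assume "x \<in> {x. \<delta> x - x \<in> lower_central 2}"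
    then show "scale r x \<in> {x. \<delta> x - x \<in> lower_central 2}"
      using subspace_scale[OF sub, of "\<delta> x - x" r]
      by (simp add: module_hom.scale[OF hom] scale_right_diff_distrib)
  qed (simp add: module_hom.zero[OF hom] subspace_0[OF sub])
  have "\<delta> (X i) - X i \<in> lower_central 2" if i: "i \<in> {1..n}" for i
  proof -
    have tail: "(\<Sum>j | j \<in> {1..n} \<and> w j > w i. scale (a i j) (X j)) \<in> lower_central 2"
      using w_pos[OF i] X_in_lower_central_iff[of _ 2]
      by (intro subspace_sum[OF sub] subspace_scale[OF sub]) auto
    have "scale (of_nat (w i) - 1) (X i) \<in> lower_central 2"
    proof (cases "w i = 1")
      case True
      then show ?thesis by (simp add: subspace_0[OF sub])
    next
      case False
      then show ?thesis
        using w_pos[OF i] X_in_lower_central_iff[OF i, of 2] by (intro subspace_scale[OF sub]) auto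
    qed
    from subspace_add[OF sub this tail] show ?thesis
      using a i by (simp add: graded_coeffs_def scale_left_diff_distrib algebra_simps)
  qed
  then show ?thesis
    unfolding identity_on_abelianization_iff using subspace_basis_UNIV[OF S] by blast
qed

text \<open>\<open>derivation_on_lower_central\<close> at \<open>j = w i\<close> puts the remainder
  in \<open>L_(w i + 1)\<close>, the span of the \<open>X k\<close> of degree above
  \<open>w i\<close>. Choice collects the rows into one array.\<close>

lemma graded_if_derivation:
  assumes "derivation \<delta>" "identity_on_abelianization \<delta>"
  shows "\<exists>a. graded_coeffs \<delta> a"
proof -
  have "\<exists>u. \<delta> (X i) = scale (of_nat (w i)) (X i)
      + (\<Sum>j | j \<in> {1..n} \<and> w j > w i. scale (u j) (X j))" if i: "i \<in> {1..n}" for i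
  proof -
    have "\<delta> (X i) - scale (of_nat (w i)) (X i) \<in> lower_central (Suc (w i))"
      using assms i identity_on_abelianization_iff w_pos X_in_lower_central_w
      by (intro derivation_on_lower_central) auto
    then obtain u where "\<delta> (X i) - scale (of_nat (w i)) (X i) =
        (\<Sum>k | k \<in> {1..n} \<and> Suc (w i) \<le> w k. scale (u k) (X k))"
      by (rule lower_central_coeffs[rotated]) simp_all
    then show ?thesis
      by (intro exI[of _ u]) (simp only: Suc_le_eq diff_eq_eq add.commute)
  qed
  then show ?thesis
    unfolding graded_coeffs_def by (intro bchoice ballI)
qed

section \<open>The equivalence, and coefficients in \<open>F\<close>\<close>

lemma derivation_identity_iff:
  assumes "Vector_Spaces.linear scale scale \<delta>"
  shows "derivation \<delta> \<and> identity_on_abelianization \<delta> \<longleftrightarrow>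
    (\<exists>a. graded_coeffs \<delta> a \<and> coefficient_equations n w c a)"
  using graded_if_derivation derivation_iff_coefficient_equations[OF assms]
    identity_on_abelianization_if_graded[OF assms] by blast

text \<open>By uniqueness of coordinates, \<open>a i j\<close> is an entry of the matrix of
  \<open>\<delta>\<close>. This identifies only entries with \<open>w j > w i\<close>; the others
  are arbitrary.\<close>

lemma graded_coeffs_in:
  assumes "map_defined_over F X n \<delta>" and a: "graded_coeffs \<delta> a"
    and ij: "i \<in> {1..n}" "j \<in> {1..n}" "w j > w i"
  shows "a i j \<in> F"
proof -
  obtain b where b: "\<forall>i\<in>{1..n}. \<forall>j\<in>{1..n}. b i j \<in> F"
    "\<forall>i\<in>{1..n}. \<delta> (X i) = (\<Sum>j=1..n. scale (b i j) (X j))"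
    using assms(1) unfolding map_defined_over_def by blast
  have "(\<Sum>k=1..n. scale (if k = i then of_nat (w i) else if w k > w i then a i k else 0) (X k)) =
      (\<Sum>k=1..n. scale (b i k) (X k))"
    using b(2) ij(1) unfolding graded_coeffs_expansion[OF a ij(1), symmetric] by blast
  then have "(if j = i then of_nat (w i) else if w j > w i then a i j else 0) = b i j"
    by (rule coeffs_unique) (rule ij)
  moreover have "j \<noteq> i" using ij(3) by blast
  ultimately have "a i j = b i j" using ij(3) by simp
  with b(1) ij show ?thesis by simp
qed

end

theorem proposition3p5:
  fixes scale :: "'f::field_char_0 \<Rightarrow> 'v::ab_group_add \<Rightarrow> 'v"
    and bracket :: "'v \<Rightarrow> 'v \<Rightarrow> 'v"
    and F :: "'f set"
    and n :: nat
    and X :: "nat \<Rightarrow> 'v"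
    and w :: "nat \<Rightarrow> nat"
    and c :: "nat \<Rightarrow> nat \<Rightarrow> nat \<Rightarrow> 'f"
    and \<delta> :: "'v \<Rightarrow> 'v"
  assumes "lie_algebra scale bracket"
    and "lie_algebra.finite_dimensional scale"
    and "lie_algebra.nilpotent scale bracket"
    and "is_subfield F"
    and "lie_algebra.defined_over scale bracket F"
    and "lie_algebra.adapted_basis scale bracket X n"
    and "\<forall>i\<in>{1..n}. w i = lie_algebra.degree scale bracket (X i)"
    and "lie_algebra.structure_coefficients scale bracket X n c"
    and "\<forall>i\<in>{1..n}. \<forall>j\<in>{1..n}. \<forall>k\<in>{1..n}. c i j k \<in> F"
    and "Vector_Spaces.linear scale scale \<delta>"
  shows "(lie_algebra.derivation scale bracket \<delta> \<and>
            lie_algebra.identity_on_abelianization scale bracket \<delta> \<longleftrightarrow>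
          (\<exists>a :: nat \<Rightarrow> nat \<Rightarrow> 'f.
             (\<forall>i\<in>{1..n}. \<delta> (X i) = scale (of_nat (w i)) (X i)
                + (\<Sum>j | j \<in> {1..n} \<and> w j > w i. scale (a i j) (X j))) \<and>
             coefficient_equations n w c a))
       \<and> (lie_algebra.map_defined_over scale F X n \<delta> \<longrightarrow>
          (lie_algebra.derivation scale bracket \<delta> \<and>
            lie_algebra.identity_on_abelianization scale bracket \<delta> \<longleftrightarrow>
          (\<exists>a :: nat \<Rightarrow> nat \<Rightarrow> 'f.
             (\<forall>i\<in>{1..n}. \<forall>j\<in>{1..n}. w j > w i \<longrightarrow> a i j \<in> F) \<and>
             (\<forall>i\<in>{1..n}. \<delta> (X i) = scale (of_nat (w i)) (X i)
                + (\<Sum>j | j \<in> {1..n} \<and> w j > w i. scale (a i j) (X j))) \<and>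
             coefficient_equations n w c a)))"
proof -
  interpret lie_algebra scale bracket by (rule assms(1))
  interpret adapted_lie_algebra scale bracket X n w c
    using assms(3,6,7,8) by unfold_locales blast+
  note iff = derivation_identity_iff[OF assms(10)]
  \<comment> \<open>The same \<open>a\<close> serves on both sides: \<open>graded_coeffs_in\<close>
    shows that its relevant entries already lie in \<open>F\<close>.\<close>
  have "(\<exists>a. graded_coeffs \<delta> a \<and> coefficient_equations n w c a) \<longleftrightarrow>
      (\<exists>a. (\<forall>i\<in>{1..n}. \<forall>j\<in>{1..n}. w j > w i \<longrightarrow> a i j \<in> F) \<and>
        graded_coeffs \<delta> a \<and> coefficient_equations n w c a)"
    if "map_defined_over F X n \<delta>"
    using graded_coeffs_in[OF that] by blast
  note over_F = trans[OF iff this]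
  show ?thesis
    by (rule conjI[OF iff[unfolded graded_coeffs_def] impI[OF over_F[unfolded graded_coeffs_def]]])
qed

end
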